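(* For $n\ge1$ let $\mathcal{S}_n=\{A+A : A\subseteq \mathbb{F}_2^n\}$, where $A+A=\{a+b: a,b\in A\}$, and let $\mathcal{H}_n=\{S\subseteq \mathbb{F}_2^n : \exists\, v\in\mathbb{F}_2^n \text{ with } v^\perp\subseteq S\}$. Then $|\mathcal{H}_n\setminus \mathcal{S}_n| = o(|\mathcal{H}_n|)$ as $n\to\infty$.
   Context: $v^\perp=\{x\in\mathbb{F}_2^n : \langle x,v\rangle=0\}$ with the standard bilinear form over $\mathbb{F}_2$. In $A+A$ the sums $a+a$ are included. *)

theory Defs
  imports
    "Jordan_Normal_Form.Matrix"
    "HOL-Library.Z2"
    "HOL-Library.Set_Algebras"
    "HOL-Library.Landau_Symbols"
begin

text \<open>
  The field with two elements is \<^typ>\<open>bit\<close>, and its \<open>n\<close>-dimensional coordinate space is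
  \<^term>\<open>carrier_vec n :: bit vec set\<close>. The sum of two sets is the Minkowski sum of
  \<^theory>\<open>HOL-Library.Set_Algebras\<close>, so \<open>A + A\<close> includes the sums \<open>a + a\<close>.
\<close>

definition F2_space :: "nat \<Rightarrow> bit vec set" where
  "F2_space n = carrier_vec n"

definition perp :: "nat \<Rightarrow> bit vec \<Rightarrow> bit vec set" where
  "perp n v = {x \<in> F2_space n. x \<bullet> v = 0}"

definition sumset_family :: "nat \<Rightarrow> bit vec set set" where
  "sumset_family n = {A + A | A. A \<subseteq> F2_space n}"

definition hyperplane_family :: "nat \<Rightarrow> bit vec set set" where
  "hyperplane_family n = {S. S \<subseteq> F2_space n \<and> (\<exists>v \<in> F2_space n. perp n v \<subseteq> S)}"

end

theory Submission
  imports Defs "HOL-Real_Asymp.Real_Asymp"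
begin

text \<open>
  Let \<open>S\<close> contain the hyperplane \<open>H = v\<^sup>\<bottom>\<close> with complement \<open>K\<close>, and put \<open>A = (S \<inter> K) \<union> {0}\<close>.
  Then \<open>A + A = S\<close> as soon as every \<open>x \<in> H\<close> is a difference of two elements of \<open>S \<inter> K\<close>.
  For \<open>x = 0\<close> this fails only if \<open>S = H\<close>; for fixed \<open>v\<close> and \<open>x \<noteq> 0\<close> it fails only if \<open>S\<close> contains at most one point of each
  pair \<open>{y, y + x} \<subseteq> K\<close>, which leaves at most \<open>3\<close> choices instead of \<open>4\<close> on each of the
  \<open>2\<^sup>n\<^sup>-\<^sup>2\<close> pairs. Hence there are at most \<open>4\<^sup>n 3\<^bsup>2^(n-2)\<^esup>\<close> exceptional sets, against at least
  \<open>4\<^bsup>2^(n-2)\<^esup>\<close> sets containing a hyperplane.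
\<close>

section \<open>Subsets without a point and its image under an involution\<close>

text \<open>Induction that removes one orbit \<open>{y, f y}\<close> at a time: a fixed point lies
  in no admissible \<open>T\<close>, and a genuine pair meets \<open>T\<close> in at most one point,
  so 3 of its 4 subsets remain.\<close>

lemma card_involution_free_subsets:
  fixes K :: "'a set"
  assumes "finite K" and "\<And>y. y \<in> K \<Longrightarrow> f y \<in> K" and "\<And>y. y \<in> K \<Longrightarrow> f (f y) = y"
  shows "card {T. T \<subseteq> K \<and> (\<forall>y\<in>T. f y \<notin> T)} \<le> 3 ^ (card K div 2)"
  using assms
proof (induction "card K" arbitrary: K rule: less_induct)
  case less
  let ?B = "\<lambda>K. {T. T \<subseteq> K \<and> (\<forall>y\<in>T. f y \<notin> T)}"
  have finB: "finite (?B L)" if "finite L" for L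
    using that by simp
  show ?case
  proof (cases "K = {}")
    case True
    then have "?B K = {{}}"
      by auto
    then show ?thesis
      by simp
  next
    case False
    then obtain y where y: "y \<in> K"
      by blast
    define L where "L = K - {y, f y}"
    have fy: "f y \<in> K" "f (f y) = y"
      using less.prems y by auto
    have L: "finite L" "card L < card K" "L \<subseteq> K"
      using less.prems(1) y by (auto simp: L_def intro!: psubset_card_mono)
    have fL: "f z \<in> L" if "z \<in> L" for z
      using that less.prems(2,3) fy unfolding L_def by (metis DiffD1 DiffD2 DiffI insert_iff singletonD)
    have IH: "card (?B L) \<le> 3 ^ (card L div 2)"
      using less.hyps[OF L(2) L(1)] fL less.prems(3) L(3) by blast
    show ?thesis
    proof (cases "f y = y")
      case True
      \<comment> \<open>A fixed point in \<open>T\<close> would have its image in \<open>T\<close>,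
        so deleting it from \<open>K\<close> loses no admissible set.\<close>
      have "?B K \<subseteq> ?B L"
        using True by (auto simp: L_def)
      then have "card (?B K) \<le> card (?B L)"
        by (intro card_mono finB L)
      also note IH
      also have "(3::nat) ^ (card L div 2) \<le> 3 ^ (card K div 2)"
        using L(2) by (intro power_increasing div_le_mono) auto
      finally show ?thesis .
    next
      case False
      let ?P = "{{}, {y}, {f y}}"
      \<comment> \<open>Splitting \<open>T\<close> along the orbit embeds \<open>?B K\<close> into a
        product whose second factor has three elements.\<close>
      have "inj_on (\<lambda>T. (T \<inter> L, T \<inter> {y, f y})) (?B K)"
      proof (rule inj_onI)
        fix T T' assume *: "T \<in> ?B K" "T' \<in> ?B K"
          "(T \<inter> L, T \<inter> {y, f y}) = (T' \<inter> L, T' \<inter> {y, f y})"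
        have "T = (T \<inter> L) \<union> (T \<inter> {y, f y})" "T' = (T' \<inter> L) \<union> (T' \<inter> {y, f y})"
          using *(1,2) unfolding L_def by blast+
        then show "T = T'"
          using *(3) by simp
      qed
      moreover have "(\<lambda>T. (T \<inter> L, T \<inter> {y, f y})) ` ?B K \<subseteq> ?B L \<times> ?P"
      proof
        fix p assume "p \<in> (\<lambda>T. (T \<inter> L, T \<inter> {y, f y})) ` ?B K"
        then obtain T where T: "T \<in> ?B K" "p = (T \<inter> L, T \<inter> {y, f y})"
          by blast
        then have "y \<notin> T \<or> f y \<notin> T"
          by blast
        then have "T \<inter> {y, f y} \<in> ?P"
          by (cases "y \<in> T"; cases "f y \<in> T") simp_all
        moreover have "T \<inter> L \<in> ?B L"
          using T(1) by blast
        ultimately show "p \<in> ?B L \<times> ?P"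
          using T(2) by blast
      qed
      ultimately have "card (?B K) \<le> card (?B L \<times> ?P)"
        using finB[OF L(1)] by (intro card_inj_on_le[where f = "\<lambda>T. (T \<inter> L, T \<inter> {y, f y})"]) auto
      also have "\<dots> = card (?B L) * 3"
        using False by (simp add: card_cartesian_product)
      also have "\<dots> \<le> 3 ^ (card L div 2) * 3"
        using IH by simp
      also have "\<dots> = 3 ^ ((card L + 2) div 2)"
        by simp
      also have "card L + 2 = card K"
      proof -
        have "card L = card K - card {y, f y}"
          unfolding L_def using y fy by (intro card_Diff_subset) auto
        moreover have "card {y, f y} \<le> card K"
          using y fy less.prems(1) by (intro card_mono) auto
        ultimately show ?thesis
          using False by simp
      qed
      finally show ?thesis .
    qed
  qed
qed

section \<open>Hyperplanes and their complements over the field with two elements\<close>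

lemma add_self_F2_vec: "v \<in> carrier_vec n \<Longrightarrow> v + v = (0\<^sub>v n :: bit vec)"
  by (intro eq_vecI) auto

lemma add_add_self_F2_vec:
  "y \<in> carrier_vec n \<Longrightarrow> x \<in> carrier_vec n \<Longrightarrow> y + x + x = (y :: bit vec)"
  by (simp add: assoc_add_vec[of _ n] add_self_F2_vec)

lemma card_F2_space: "finite (F2_space n)" "card (F2_space n) = 2 ^ n"
proof -
  let ?X = "{xs. set xs \<subseteq> (UNIV :: bit set) \<and> length xs = n}"
  have UNIV_bit: "(UNIV :: bit set) = {0, 1}"
    using bit_not_zero_iff by blast
  have fin: "finite (UNIV :: bit set)" and card: "card (UNIV :: bit set) = 2"
    unfolding UNIV_bit by simp_all
  have bij: "bij_betw list_of_vec (F2_space n) ?X"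
    by (rule bij_betw_byWitness[where f' = vec_of_list])
      (auto simp: F2_space_def vec_list list_vec intro: carrier_vecI)
  show "finite (F2_space n)"
    using bij_betw_finite[OF bij] finite_lists_length_eq[OF fin] by simp
  show "card (F2_space n) = 2 ^ n"
    using bij_betw_same_card[OF bij] card_lists_length_eq[OF fin, of n] card by simp
qed

abbreviation coperp :: "nat \<Rightarrow> bit vec \<Rightarrow> bit vec set" where
  "coperp n v \<equiv> F2_space n - perp n v"

lemma scalar_prod_F2_add:
  "y \<in> F2_space n \<Longrightarrow> z \<in> F2_space n \<Longrightarrow> v \<in> F2_space n \<Longrightarrow> (y + z) \<bullet> v = y \<bullet> v + z \<bullet> v"
  by (simp add: F2_space_def add_scalar_prod_distrib)

lemma coperp_add_perp:
  "v \<in> F2_space n \<Longrightarrow> y \<in> coperp n v \<Longrightarrow> x \<in> perp n v \<Longrightarrow> y + x \<in> coperp n v"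
  by (auto simp: perp_def scalar_prod_F2_add) (auto simp: F2_space_def)

text \<open>Outside the hyperplane the form takes the value 1, and 1 + 1 = 0 in
  \<open>bit\<close>.\<close>

lemma coperp_add_coperp:
  "v \<in> F2_space n \<Longrightarrow> y \<in> coperp n v \<Longrightarrow> z \<in> coperp n v \<Longrightarrow> y + z \<in> perp n v"
  by (auto simp: perp_def scalar_prod_F2_add) (auto simp: F2_space_def)

text \<open>Translation by a vector \<open>c\<close> off the hyperplane exchanges it with its
  complement, so each is half of the space. A nonzero coordinate of \<open>v\<close> supplies
  \<open>c\<close>.\<close>

lemma card_coperp:
  assumes v: "v \<in> F2_space n" and "v \<noteq> 0\<^sub>v n" and "n > 0"
  shows "card (coperp n v) = 2 ^ (n - 1)"
proof -
  obtain i where i: "i < n" "v $ i \<noteq> 0"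
    using assms by (auto simp: F2_space_def vec_eq_iff)
  define c :: "bit vec" where "c = unit_vec n i"
  have c: "c \<in> F2_space n" "c \<in> coperp n v"
    using i v by (auto simp: c_def F2_space_def perp_def)
  have "bij_betw (\<lambda>y. c + y) (coperp n v) (perp n v)"
  proof (rule bij_betw_byWitness[where f' = "\<lambda>y. c + y"])
    have *: "c + (c + y) = y" if "y \<in> F2_space n" for y
      using that c(1) by (simp add: F2_space_def assoc_add_vec[symmetric, of _ n] add_self_F2_vec)
    then show "\<forall>y\<in>coperp n v. c + (c + y) = y" "\<forall>y\<in>perp n v. c + (c + y) = y"
      by (auto simp: perp_def)
    show "(\<lambda>y. c + y) ` coperp n v \<subseteq> perp n v"
      using coperp_add_coperp[OF v c(2)] by blast
    show "(\<lambda>y. c + y) ` perp n v \<subseteq> coperp n v"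
      using coperp_add_perp[OF v c(2)] by blast
  qed
  then have "card (coperp n v) = card (perp n v)"
    by (rule bij_betw_same_card)
  moreover have "perp n v \<subseteq> F2_space n"
    by (auto simp: perp_def)
  then have "card (coperp n v) = 2 ^ n - card (perp n v)" "card (perp n v) \<le> 2 ^ n"
    using card_F2_space[of n] by (metis card_Diff_subset finite_subset, metis card_mono)
  moreover have "(2::nat) ^ n = 2 * 2 ^ (n - 1)"
    using \<open>n > 0\<close> by (simp flip: power_Suc)
  ultimately show ?thesis
    by linarith
qed

section \<open>A criterion for being a sumset\<close>

text \<open>The element 0 of \<open>A\<close> recovers the points of \<open>S\<close> off the
  hyperplane, two such points sum into \<open>perp n v\<close>, and \<open>diff\<close> yields each
  hyperplane point \<open>s\<close> as \<open>y + (y + s)\<close>, since differences are sums in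
  characteristic 2.\<close>

lemma sumset_of_differences:
  assumes v: "v \<in> F2_space n" and S: "S \<subseteq> F2_space n" "perp n v \<subseteq> S"
    and diff: "\<And>x. x \<in> perp n v \<Longrightarrow> \<exists>y \<in> S \<inter> coperp n v. y + x \<in> S"
  shows "S \<in> sumset_family n"
proof -
  define A where "A = insert (0\<^sub>v n) (S \<inter> coperp n v)"
  have zero: "0\<^sub>v n \<in> perp n v"
    using v by (simp add: perp_def F2_space_def)
  have A: "A \<subseteq> F2_space n"
    using zero by (auto simp: A_def perp_def)
  have "A + A \<subseteq> S"
  proof
    fix s assume "s \<in> A + A"
    then obtain a b where ab: "s = a + b" "a \<in> A" "b \<in> A"
      by (auto simp: set_plus_def)
    show "s \<in> S"
    proof (cases "a = 0\<^sub>v n \<or> b = 0\<^sub>v n")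
      case True
      moreover have "A \<subseteq> S"
        using zero S by (auto simp: A_def)
      ultimately show ?thesis
        using ab A unfolding F2_space_def by (metis left_zero_vec right_zero_vec subsetD)
    next
      case False
      then show ?thesis
        using ab coperp_add_coperp[OF v] S by (auto simp: A_def)
    qed
  qed
  moreover have "S \<subseteq> A + A"
  proof
    fix s assume s: "s \<in> S"
    show "s \<in> A + A"
    proof (cases "s \<in> perp n v")
      case True
      then obtain y where y: "y \<in> S \<inter> coperp n v" "y + s \<in> S"
        using diff by blast
      then have "y \<in> A" "y + s \<in> A"
        using coperp_add_perp[OF v _ True] by (auto simp: A_def)
      moreover have "y + (y + s) = s"
        using s y S(1) by (auto simp: F2_space_def assoc_add_vec[symmetric, of _ n] add_self_F2_vec)
      ultimately show ?thesis
        by (metis set_plus_intro)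
    next
      case False
      then have "s \<in> A" "0\<^sub>v n \<in> A"
        using s S by (auto simp: A_def)
      moreover have "s + 0\<^sub>v n = s"
        using s S by (auto simp: F2_space_def)
      ultimately show ?thesis
        by (metis set_plus_intro)
    qed
  qed
  ultimately show ?thesis
    using A by (auto simp: sumset_family_def)
qed

text \<open>Settles \<open>v = 0\<close>: its \<open>perp\<close> is the whole space, so the
  complement is empty and the criterion above cannot apply.\<close>

lemma F2_space_sumset: "F2_space n \<in> sumset_family n"
proof -
  have "F2_space n + F2_space n = F2_space n"
  proof
    show "F2_space n + F2_space n \<subseteq> F2_space n"
      by (auto simp: set_plus_def F2_space_def)
    show "F2_space n \<subseteq> F2_space n + F2_space n"
    proof
      fix x assume "x \<in> F2_space n"
      moreover from this have "x + 0\<^sub>v n = x" "0\<^sub>v n \<in> F2_space n"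
        by (auto simp: F2_space_def)
      ultimately show "x \<in> F2_space n + F2_space n"
        by (metis set_plus_intro)
    qed
  qed
  then show ?thesis
    by (auto simp: sumset_family_def)
qed

section \<open>Counting the family and its exceptional members\<close>

lemma finite_hyperplane_family: "finite (hyperplane_family n)"
  by (rule finite_subset[of _ "Pow (F2_space n)"])
    (auto simp: hyperplane_family_def card_F2_space)

lemma card_hyperplane_family_ge:
  assumes "n > 0"
  shows "2 ^ 2 ^ (n - 1) \<le> card (hyperplane_family n)"
proof -
  define v :: "bit vec" where "v = unit_vec n 0"
  have v: "v \<in> F2_space n" "v \<noteq> 0\<^sub>v n"
    using assms by (auto simp: v_def F2_space_def vec_eq_iff)
  \<comment> \<open>A single hyperplane is enough for the lower bound: its complement may be filled
    arbitrarily.\<close>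
  have "card (Pow (coperp n v)) \<le> card (hyperplane_family n)"
  proof (rule card_inj_on_le[where f = "\<lambda>T. perp n v \<union> T"])
    show "inj_on (\<lambda>T. perp n v \<union> T) (Pow (coperp n v))"
      by (rule inj_onI) blast
    show "(\<lambda>T. perp n v \<union> T) ` Pow (coperp n v) \<subseteq> hyperplane_family n"
      using v by (auto simp: hyperplane_family_def perp_def)
  qed (rule finite_hyperplane_family)
  then show ?thesis
    using card_coperp[OF v assms] card_F2_space by (simp add: card_Pow)
qed

text \<open>As \<open>S\<close> contains \<open>perp n v\<close>, it is determined by its trace on
  the complement, where translation by \<open>x\<close> is an involution. The case
  \<open>x = 0\<close> is included: every point is then fixed and only the empty trace
  survives.\<close>

lemma card_difference_free:
  assumes v: "v \<in> F2_space n" and x: "x \<in> perp n v"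
  shows "card {S. S \<subseteq> F2_space n \<and> perp n v \<subseteq> S \<and> (\<forall>y \<in> S \<inter> coperp n v. y + x \<notin> S)}
    \<le> 3 ^ (card (coperp n v) div 2)"
    (is "card ?D \<le> _")
proof -
  let ?B = "{T. T \<subseteq> coperp n v \<and> (\<forall>y\<in>T. y + x \<notin> T)}"
  have "finite ?B"
    using card_F2_space by simp
  moreover have "inj_on (\<lambda>S. S \<inter> coperp n v) ?D"
    by (rule inj_onI) blast
  moreover have "(\<lambda>S. S \<inter> coperp n v) ` ?D \<subseteq> ?B"
    by blast
  ultimately have "card ?D \<le> card ?B"
    by (intro card_inj_on_le)
  also have "\<dots> \<le> 3 ^ (card (coperp n v) div 2)"
  proof (rule card_involution_free_subsets)
    show "finite (coperp n v)"
      using card_F2_space by simp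
    show "y + x \<in> coperp n v" if "y \<in> coperp n v" for y
      using coperp_add_perp[OF v that x] .
    show "y + x + x = y" if "y \<in> coperp n v" for y
      using that x by (auto simp: perp_def F2_space_def add_add_self_F2_vec)
  qed
  finally show ?thesis .
qed

lemma card_hyperplane_not_sumset_le:
  assumes "n > 0"
  shows "card (hyperplane_family n - sumset_family n) \<le> 2 ^ n * (2 ^ n * 3 ^ (2 ^ (n - 1) div 2))"
proof -
  define D where "D v x =
    {S. S \<subseteq> F2_space n \<and> perp n v \<subseteq> S \<and> (\<forall>y \<in> S \<inter> coperp n v. y + x \<notin> S)}" for v x
  let ?V = "F2_space n - {0\<^sub>v n}"
  let ?q = "3 ^ (2 ^ (n - 1) div 2) :: nat"
  have fin: "finite (F2_space n)"
    by (rule card_F2_space)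
  have finp: "finite (perp n v)" and cardp: "card (perp n v) \<le> 2 ^ n" for v
    using fin card_mono[OF fin, of "perp n v"] card_F2_space(2)[of n] by (auto simp: perp_def)
  \<comment> \<open>Union bound: an exceptional \<open>S\<close> violates the criterion for some
    nonzero \<open>v\<close> and some \<open>x\<close>, with at most \<open>2 ^ n\<close> choices
    for each.\<close>
  have "hyperplane_family n - sumset_family n \<subseteq> (\<Union>v\<in>?V. \<Union>x\<in>perp n v. D v x)"
  proof
    fix S assume S: "S \<in> hyperplane_family n - sumset_family n"
    then obtain v where v: "v \<in> F2_space n" "perp n v \<subseteq> S" "S \<subseteq> F2_space n"
      by (auto simp: hyperplane_family_def)
    have "perp n (0\<^sub>v n) = F2_space n"
      by (auto simp: perp_def F2_space_def)
    then have "v \<noteq> 0\<^sub>v n"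
      using S v F2_space_sumset[of n] by auto
    moreover obtain x where "x \<in> perp n v" "\<forall>y \<in> S \<inter> coperp n v. y + x \<notin> S"
      using sumset_of_differences[OF v(1,3,2)] S by blast
    ultimately show "S \<in> (\<Union>v\<in>?V. \<Union>x\<in>perp n v. D v x)"
      using v by (auto simp: D_def)
  qed
  moreover have "finite (\<Union>v\<in>?V. \<Union>x\<in>perp n v. D v x)"
    by (rule finite_subset[of _ "Pow (F2_space n)"]) (auto simp: D_def fin)
  ultimately have "card (hyperplane_family n - sumset_family n)
      \<le> card (\<Union>v\<in>?V. \<Union>x\<in>perp n v. D v x)"
    by (intro card_mono)
  also have "\<dots> \<le> (\<Sum>v\<in>?V. card (\<Union>x\<in>perp n v. D v x))"
    using fin by (intro card_UN_le) auto
  also have "\<dots> \<le> (\<Sum>v\<in>?V. 2 ^ n * ?q)"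
  proof (rule sum_mono)
    fix v assume v: "v \<in> ?V"
    have "card (\<Union>x\<in>perp n v. D v x) \<le> (\<Sum>x\<in>perp n v. card (D v x))"
      by (intro card_UN_le finp)
    also have "\<dots> \<le> (\<Sum>x\<in>perp n v. ?q)"
    proof (rule sum_mono)
      fix x assume "x \<in> perp n v"
      then show "card (D v x) \<le> ?q"
        using card_difference_free[of v n x] card_coperp[of v n] v assms by (simp add: D_def)
    qed
    also have "\<dots> \<le> 2 ^ n * ?q"
      using cardp by simp
    finally show "card (\<Union>x\<in>perp n v. D v x) \<le> 2 ^ n * ?q" .
  qed
  also have "\<dots> \<le> 2 ^ n * (2 ^ n * ?q)"
    using card_mono[OF fin, of ?V] card_F2_space(2)[of n] by simp
  finally show ?thesis .
qed

section \<open>Asymptotic comparison\<close>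

theorem theorem4p2:
  shows "(\<lambda>n. real (card (hyperplane_family n - sumset_family n)))
           \<in> o[sequentially](\<lambda>n. real (card (hyperplane_family n)))"
proof -
  define a where "a n = real (card (hyperplane_family n - sumset_family n))" for n
  define h where "h n = real (card (hyperplane_family n))" for n
  \<comment> \<open>Here \<open>N = 2 ^ (n - 2)\<close> is the number of translation pairs:
    \<open>2 ^ n * 2 ^ n = 16 * N ^ 2\<close>, and 3/4 compares 3 choices per pair with all 4. The
    restriction to \<open>n \<ge> 2\<close> below avoids truncated subtraction.\<close>
  define u where "u N = 16 * real N ^ 2 * (3 / 4 :: real) ^ N" for N
  have bound: "a n \<le> u (2 ^ (n - 2)) * h n" if "n \<ge> 2" for n
  proof -
    obtain m where m: "n = m + 2"
      using \<open>n \<ge> 2\<close> by (metis add.commute le_Suc_ex)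
    have "a n \<le> real (2 ^ n * (2 ^ n * 3 ^ (2 ^ (n - 1) div 2)))"
      unfolding a_def of_nat_le_iff using m by (intro card_hyperplane_not_sumset_le) simp
    also have "\<dots> = 16 * real (2 ^ m) ^ 2 * 3 ^ 2 ^ m"
      by (simp add: m power2_eq_square)
    also have "\<dots> = u (2 ^ m) * 4 ^ 2 ^ m"
      by (simp add: u_def power_divide)
    also have "(4::real) ^ 2 ^ m = real (2 ^ 2 ^ (n - 1))"
      by (simp add: m power_mult)
    also have "u (2 ^ m) * real (2 ^ 2 ^ (n - 1)) \<le> u (2 ^ m) * h n"
      unfolding h_def using card_hyperplane_family_ge[of n] m
      by (intro mult_left_mono of_nat_mono) (auto simp: u_def)
    finally show ?thesis
      by (simp add: m)
  qed
  \<comment> \<open>The limit is taken in \<open>N\<close> first, where a geometric factor beats a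
    polynomial, and only then composed with \<open>N = 2 ^ (n - 2)\<close>.\<close>
  have "u \<longlonglongrightarrow> 0"
    unfolding u_def by real_asymp
  moreover have "filterlim (\<lambda>n. 2 ^ (n - 2) :: nat) at_top sequentially"
    by real_asymp
  ultimately have lim: "(\<lambda>n. u (2 ^ (n - 2))) \<longlonglongrightarrow> 0"
    by (rule filterlim_compose)
  have "a \<in> o[sequentially](h)"
  proof (rule landau_o.smallI)
    fix c :: real assume "c > 0"
    then have "eventually (\<lambda>n. u (2 ^ (n - 2)) < c) sequentially"
      using lim by (rule order_tendstoD(2)[rotated])
    then show "eventually (\<lambda>n. norm (a n) \<le> c * norm (h n)) sequentially"
      using eventually_ge_at_top[of 2]
    proof eventually_elim
      case (elim n)
      have "a n \<le> u (2 ^ (n - 2)) * h n"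
        using bound elim by simp
      also have "\<dots> \<le> c * h n"
        using elim by (intro mult_right_mono) (auto simp: h_def)
      finally show ?case
        by (simp add: a_def h_def)
    qed
  qed
  then show ?thesis
    by (simp add: a_def [abs_def] h_def [abs_def])
qed

end
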